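(* Let $\Gamma$ be a zero-sum stochastic game with finite state space $[n]=\{1,\dots,n\}$ (payoffs possibly unbounded) and with Shapley operator $T:\mathbb{R}^n\to\mathbb{R}^n$. Then $\Gamma$ is ergodic if and only if, for all $\alpha,\beta\in\mathbb{R}$, the slice space $\mathcal{S}_\alpha^\beta(T)=\{x\in\mathbb{R}^n \mid \alpha e+x\leq T(x)\leq \beta e+x\}$ is bounded in Hilbert's seminorm.
   Context: A (zero-sum) stochastic game is a tuple $\Gamma=([n],A,B,K_A,K_B,r,p)$ where: $[n]=\{1,\dots,n\}$ is the state space; $A,B$ are Borel spaces (Borel subsets of Polish spaces), the action spaces of players Max and Min; $K_A\subset[n]\times A$ and $K_B\subset[n]\times B$ are Borel, and $A_i=\{a\mid(i,a)\in K_A\}$, $B_i=\{b\mid(i,b)\in K_B\}$ are the actions available in state $i$; $K=\{(i,a,b)\mid i\in[n],a\in A_i,b\in B_i\}$; $r:K\to\mathbb{R}$ is a Borel measurable payoff function; $p:K\to\Delta([n])$ is a Borel measurable transition function, where $\Delta(X)$ denotes the set of Borel probability measures on $X$ and $p(\ell\mid i,a,b)$ is the probability of state $\ell$. For Borel measurable $f:K\to\mathbb{R}$, put $f(i,\mu,\nu)=\int_{A_i}\int_{B_i}f(i,a,b)\,d\mu(a)\,d\nu(b)$ for $\mu\in\Delta(A_i)$, $\nu\in\Delta(B_i)$. The Shapley operator of $\Gamma$ is $T:\mathbb{R}^n\to\mathbb{R}^n$ with $$T_i(x)=\sup_{\mu\in\Delta(A_i)}\inf_{\nu\in\Delta(B_i)}\Big\{r(i,\mu,\nu)+\sum_{\ell\in[n]}x_\ell\,p(\ell\mid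 i,\mu,\nu)\Big\}=\inf_{\nu\in\Delta(B_i)}\sup_{\mu\in\Delta(A_i)}\Big\{r(i,\mu,\nu)+\sum_{\ell\in[n]}x_\ell\,p(\ell\mid i,\mu,\nu)\Big\}.$$ Standing assumption: the Shapley operator is well defined (the sup-inf and inf-sup are equal and finite for all $i$ and $x$). No compactness or continuity is assumed. Let $e=(1,\dots,1)^\top$. The order on $\mathbb{R}^n$ is coordinatewise. The ergodic equation for a map $F:\mathbb{R}^n\to\mathbb{R}^n$ is $F(u)=\lambda e+u$ with unknowns $(\lambda,u)\in\mathbb{R}\times\mathbb{R}^n$; it is solvable if such a pair exists. The game $\Gamma$ is ergodic if for every $g\in\mathbb{R}^n$ the ergodic equation is solvable for $g+T$ (the map $x\mapsto g+T(x)$). Hilbert's seminorm is $\|x\|_{\mathrm H}=\max_i x_i-\min_i x_i$; a set is bounded in Hilbert's seminorm if $\|\cdot\|_{\mathrm H}$ is bounded on it (the empty set is bounded). *)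

theory Defs
  imports "HOL-Probability.Probability"
begin

text \<open>
  The state space is a finite type \<open>'n\<close>. The action spaces are Borel subsets of Polish types.
  Payoff and transition function are total functions of which only the restriction to
  \<open>game_K\<close> is ever used. \<open>1 :: real ^ 'n\<close> is the all-ones vector, and \<open>\<le>\<close> on
  \<open>real ^ 'n\<close> is coordinatewise.
\<close>

record ('n, 'a, 'b) game =
  space_max :: "'a set"
  space_min :: "'b set"
  graph_max :: "('n \<times> 'a) set"
  graph_min :: "('n \<times> 'b) set"
  payoff :: "'n \<times> 'a \<times> 'b \<Rightarrow> real"
  trans_prob :: "'n \<times> 'a \<times> 'b \<Rightarrow> 'n measure"

definition actions_max :: "('n, 'a, 'b) game \<Rightarrow> 'n \<Rightarrow> 'a set" where
  "actions_max G i = {a. (i, a) \<in> graph_max G}"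

definition actions_min :: "('n, 'a, 'b) game \<Rightarrow> 'n \<Rightarrow> 'b set" where
  "actions_min G i = {b. (i, b) \<in> graph_min G}"

definition game_K :: "('n, 'a, 'b) game \<Rightarrow> ('n \<times> 'a \<times> 'b) set" where
  "game_K G = {(i, a, b). a \<in> actions_max G i \<and> b \<in> actions_min G i}"

definition borel_K ::
  "('n::finite, 'a::polish_space, 'b::polish_space) game \<Rightarrow> ('n \<times> 'a \<times> 'b) measure" where
  "borel_K G = restrict_space (count_space UNIV \<Otimes>\<^sub>M (borel \<Otimes>\<^sub>M borel)) (game_K G)"

definition stochastic_game ::
  "('n::finite, 'a::polish_space, 'b::polish_space) game \<Rightarrow> bool" where
  "stochastic_game G \<longleftrightarrow>
     space_max G \<in> sets borel \<and>
     space_min G \<in> sets borel \<and>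
     graph_max G \<subseteq> UNIV \<times> space_max G \<and>
     graph_max G \<in> sets (count_space UNIV \<Otimes>\<^sub>M borel) \<and>
     graph_min G \<subseteq> UNIV \<times> space_min G \<and>
     graph_min G \<in> sets (count_space UNIV \<Otimes>\<^sub>M borel) \<and>
     payoff G \<in> borel_measurable (borel_K G) \<and>
     trans_prob G \<in> borel_K G \<rightarrow>\<^sub>M prob_algebra (count_space UNIV)"

definition borel_probs :: "'a::topological_space set \<Rightarrow> 'a measure set" where
  "borel_probs X = space (prob_algebra (restrict_space borel X))"

text \<open>
  The bilinear extension \<open>f(i, \<mu>, \<nu>)\<close> is an integral with values in the extended reals, since for
  unbounded \<open>f\<close> there are always \<open>\<mu>\<close> and \<open>\<nu>\<close> for which \<open>f\<close> is not integrable. Only if the positive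
  and the negative part both have infinite integral does the double integral fail to exist. No value
  is singled out in that case: it is given by a parameter \<open>c\<close> that stays arbitrary. The parameter
  plays no role for bounded \<open>f\<close>, in particular not for transition probabilities.
\<close>

definition mixed_ext ::
  "('n \<Rightarrow> 'a measure \<Rightarrow> 'b measure \<Rightarrow> ereal) \<Rightarrow> ('n \<times> 'a \<times> 'b \<Rightarrow> real) \<Rightarrow>
   'n \<Rightarrow> 'a measure \<Rightarrow> 'b measure \<Rightarrow> ereal" where
  "mixed_ext c f i \<mu> \<nu> =
     (let pos = \<integral>\<^sup>+ (a, b). ennreal (f (i, a, b)) \<partial>(\<mu> \<Otimes>\<^sub>M \<nu>);
          neg = \<integral>\<^sup>+ (a, b). ennreal (- f (i, a, b)) \<partial>(\<mu> \<Otimes>\<^sub>M \<nu>)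
      in if pos = \<infinity> \<and> neg = \<infinity> then c i \<mu> \<nu> else enn2ereal pos - enn2ereal neg)"

definition stage_value ::
  "('n \<Rightarrow> 'a measure \<Rightarrow> 'b measure \<Rightarrow> ereal) \<Rightarrow> ('n::finite, 'a, 'b) game \<Rightarrow>
   real ^ 'n \<Rightarrow> 'n \<Rightarrow> 'a measure \<Rightarrow> 'b measure \<Rightarrow> ereal" where
  "stage_value c G x i \<mu> \<nu> =
     mixed_ext c (payoff G) i \<mu> \<nu> +
     (\<Sum>l\<in>UNIV. ereal (x $ l) * mixed_ext c (\<lambda>k. measure (trans_prob G k) {l}) i \<mu> \<nu>)"

definition shapley_sup_inf ::
  "('n \<Rightarrow> 'a measure \<Rightarrow> 'b measure \<Rightarrow> ereal) \<Rightarrow>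
   ('n::finite, 'a::polish_space, 'b::polish_space) game \<Rightarrow> real ^ 'n \<Rightarrow> 'n \<Rightarrow> ereal" where
  "shapley_sup_inf c G x i =
     (SUP \<mu>\<in>borel_probs (actions_max G i). INF \<nu>\<in>borel_probs (actions_min G i).
        stage_value c G x i \<mu> \<nu>)"

definition shapley_inf_sup ::
  "('n \<Rightarrow> 'a measure \<Rightarrow> 'b measure \<Rightarrow> ereal) \<Rightarrow>
   ('n::finite, 'a::polish_space, 'b::polish_space) game \<Rightarrow> real ^ 'n \<Rightarrow> 'n \<Rightarrow> ereal" where
  "shapley_inf_sup c G x i =
     (INF \<nu>\<in>borel_probs (actions_min G i). SUP \<mu>\<in>borel_probs (actions_max G i).
        stage_value c G x i \<mu> \<nu>)"

definition shapley_well_defined ::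
  "('n \<Rightarrow> 'a measure \<Rightarrow> 'b measure \<Rightarrow> ereal) \<Rightarrow>
   ('n::finite, 'a::polish_space, 'b::polish_space) game \<Rightarrow> bool" where
  "shapley_well_defined c G \<longleftrightarrow>
     (\<forall>x i. shapley_sup_inf c G x i = shapley_inf_sup c G x i \<and> \<bar>shapley_sup_inf c G x i\<bar> \<noteq> \<infinity>)"

definition shapley_operator ::
  "('n \<Rightarrow> 'a measure \<Rightarrow> 'b measure \<Rightarrow> ereal) \<Rightarrow>
   ('n::finite, 'a::polish_space, 'b::polish_space) game \<Rightarrow> real ^ 'n \<Rightarrow> real ^ 'n" where
  "shapley_operator c G x = (\<chi> i. real_of_ereal (shapley_sup_inf c G x i))"

definition ergodic_eq_solvable :: "(real ^ 'n \<Rightarrow> real ^ 'n::finite) \<Rightarrow> bool" where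
  "ergodic_eq_solvable F \<longleftrightarrow> (\<exists>(lam::real) u. F u = lam *\<^sub>R 1 + u)"

definition ergodic_game ::
  "('n \<Rightarrow> 'a measure \<Rightarrow> 'b measure \<Rightarrow> ereal) \<Rightarrow>
   ('n::finite, 'a::polish_space, 'b::polish_space) game \<Rightarrow> bool" where
  "ergodic_game c G \<longleftrightarrow> (\<forall>g. ergodic_eq_solvable (\<lambda>x. g + shapley_operator c G x))"

definition slice_space ::
  "(real ^ 'n \<Rightarrow> real ^ 'n::finite) \<Rightarrow> real \<Rightarrow> real \<Rightarrow> (real ^ 'n) set" where
  "slice_space F \<alpha> \<beta> = {x. \<alpha> *\<^sub>R 1 + x \<le> F x \<and> F x \<le> \<beta> *\<^sub>R 1 + x}"

definition hilbert_seminorm :: "real ^ 'n::finite \<Rightarrow> real" where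
  "hilbert_seminorm x = Max (range (\<lambda>i. x $ i)) - Min (range (\<lambda>i. x $ i))"

definition hilbert_bounded :: "(real ^ 'n::finite) set \<Rightarrow> bool" where
  "hilbert_bounded S \<longleftrightarrow> (\<exists>M. \<forall>x\<in>S. hilbert_seminorm x \<le> M)"

end

theory Submission
  imports Defs
begin

text \<open>
  The Shapley operator \<open>T\<close> is monotone and commutes with the addition of constants, hence it is
  nonexpansive in Hilbert's seminorm \<open>q\<close>. No other property of the game matters.

  If the slices are bounded, let \<open>x\<close> be a fixed point of the discounted map \<open>x \<mapsto> T ((1 - \<delta>) x)\<close>,
  which leaves a box invariant. The points \<open>y = (1 - \<delta>) x\<close> satisfy \<open>T y - y = \<delta> x\<close> and lie in one
  slice for all \<open>\<delta>\<close>, so modulo constants they accumulate at some \<open>u\<close> as \<open>\<delta> \<rightarrow> 0\<close>, and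
  \<open>q (\<delta> x) \<rightarrow> 0\<close> makes \<open>T u - u\<close> constant.

  Conversely, \<open>f = I - T\<close> is accretive: \<open>q (x - z) \<le> q (x - z + s (f x - f z))\<close> for \<open>s \<ge> 0\<close>. Suppose
  that points \<open>x\<^sub>k\<close> of a slice go to infinity in the direction \<open>d\<close>, and solve \<open>f z = C d\<close> modulo
  constants, for a large \<open>C\<close>. With \<open>s = q x\<^sub>k / C\<close> the right-hand side is then a small fraction of
  \<open>q x\<^sub>k\<close>, while the left-hand side is asymptotically equal to \<open>q x\<^sub>k\<close>.
\<close>

section \<open>Hilbert's seminorm\<close>

text \<open>Reduces each estimate of the seminorm to pairs of coordinates, so that no maximum or
  minimum of a sum has to be computed.\<close>

lemma hilbert_seminorm_le_iff:
  "hilbert_seminorm x \<le> M \<longleftrightarrow> (\<forall>i j. x $ i - x $ j \<le> M)"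
proof
  assume *: "hilbert_seminorm x \<le> M"
  show "\<forall>i j. x $ i - x $ j \<le> M"
  proof (intro allI)
    fix i j
    have "x $ i \<le> Max (range (($) x))" "Min (range (($) x)) \<le> x $ j"
      by auto
    with * show "x $ i - x $ j \<le> M"
      unfolding hilbert_seminorm_def by linarith
  qed
next
  assume *: "\<forall>i j. x $ i - x $ j \<le> M"
  have "Max (range (($) x)) \<in> range (($) x)" "Min (range (($) x)) \<in> range (($) x)"
    by (intro Max_in Min_in; simp)+
  then obtain i j where "Max (range (($) x)) = x $ i" "Min (range (($) x)) = x $ j"
    by (meson rangeE)
  with * show "hilbert_seminorm x \<le> M"
    by (simp add: hilbert_seminorm_def)
qed

lemma diff_le_hilbert_seminorm: "x $ i - x $ j \<le> hilbert_seminorm x"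
  using hilbert_seminorm_le_iff by blast

lemma hilbert_seminorm_nonneg: "0 \<le> hilbert_seminorm x"
  \<comment> \<open>\<open>undefined\<close> is just some index, available because types are
    nonempty.\<close>
  using diff_le_hilbert_seminorm[of x undefined undefined] by simp

lemma hilbert_seminorm_triangle:
  "hilbert_seminorm (x + y) \<le> hilbert_seminorm x + hilbert_seminorm y"
  unfolding hilbert_seminorm_le_iff
proof (intro allI)
  fix i j
  show "(x + y) $ i - (x + y) $ j \<le> hilbert_seminorm x + hilbert_seminorm y"
    using diff_le_hilbert_seminorm[of x i j] diff_le_hilbert_seminorm[of y i j] by simp
qed

lemma hilbert_seminorm_minus [simp]: "hilbert_seminorm (- x) = hilbert_seminorm x"
proof (rule antisym)
  show "hilbert_seminorm (- x) \<le> hilbert_seminorm x"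
    unfolding hilbert_seminorm_le_iff
    using diff_le_hilbert_seminorm[of x] by (simp add: algebra_simps)
  show "hilbert_seminorm x \<le> hilbert_seminorm (- x)"
    unfolding hilbert_seminorm_le_iff
    using diff_le_hilbert_seminorm[of "- x"] by (simp add: algebra_simps)
qed

lemma hilbert_seminorm_scaleR_le:
  assumes "0 \<le> s"
  shows "hilbert_seminorm (s *\<^sub>R x) \<le> s * hilbert_seminorm x"
  unfolding hilbert_seminorm_le_iff
proof (intro allI)
  fix i j
  show "(s *\<^sub>R x) $ i - (s *\<^sub>R x) $ j \<le> s * hilbert_seminorm x"
    using mult_left_mono[OF diff_le_hilbert_seminorm[of x i j] assms] by (simp add: algebra_simps)
qed

lemma hilbert_seminorm_scaleR:
  assumes "0 \<le> s"
  shows "hilbert_seminorm (s *\<^sub>R x) = s * hilbert_seminorm x"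
proof (cases "s = 0")
  case True
  then show ?thesis
    using hilbert_seminorm_scaleR_le[OF assms, of x] hilbert_seminorm_nonneg[of "s *\<^sub>R x"] by simp
next
  case False
  have "hilbert_seminorm x \<le> inverse s * hilbert_seminorm (s *\<^sub>R x)"
    using hilbert_seminorm_scaleR_le[of "inverse s" "s *\<^sub>R x"] False assms by simp
  then have "s * hilbert_seminorm x \<le> hilbert_seminorm (s *\<^sub>R x)"
    using False assms by (simp add: field_simps)
  with hilbert_seminorm_scaleR_le[OF assms, of x] show ?thesis
    by simp
qed

lemma hilbert_seminorm_add_const [simp]:
  "hilbert_seminorm (x + t *\<^sub>R 1) = hilbert_seminorm x"
proof (rule antisym)
  show "hilbert_seminorm (x + t *\<^sub>R 1) \<le> hilbert_seminorm x"
    unfolding hilbert_seminorm_le_iff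
    using diff_le_hilbert_seminorm[of x] by simp
  show "hilbert_seminorm x \<le> hilbert_seminorm (x + t *\<^sub>R 1)"
    unfolding hilbert_seminorm_le_iff
    using diff_le_hilbert_seminorm[of "x + t *\<^sub>R 1"] by simp
qed

lemma hilbert_seminorm_le_norm: "hilbert_seminorm x \<le> 2 * norm x"
  unfolding hilbert_seminorm_le_iff
proof (intro allI)
  fix i j
  show "x $ i - x $ j \<le> 2 * norm x"
    using component_le_norm_cart[of x i] component_le_norm_cart[of x j] by linarith
qed

text \<open>The source of compactness in both directions: modulo constants, a set bounded in
  Hilbert's seminorm lies in a box.\<close>

lemma normalised_in_cbox:
  fixes x :: "real ^ 'n::finite"
  shows "x - Min (range (($) x)) *\<^sub>R 1 \<in> cbox 0 (hilbert_seminorm x *\<^sub>R 1)"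
  by (auto simp: mem_box_cart hilbert_seminorm_def)


section \<open>Monotone additively homogeneous maps\<close>

definition topical :: "(real ^ 'n::finite \<Rightarrow> real ^ 'n) \<Rightarrow> bool" where
  "topical F \<longleftrightarrow> mono F \<and> (\<forall>x t. F (x + t *\<^sub>R 1) = F x + t *\<^sub>R 1)"

lemma topical_add_const:
  assumes "topical F"
  shows "F (x + t *\<^sub>R 1) = F x + t *\<^sub>R 1"
  using assms by (simp add: topical_def)

lemma topical_diff_const:
  assumes "topical F"
  shows "F (x - t *\<^sub>R 1) = F x - t *\<^sub>R 1"
  using topical_add_const[OF assms, of x "- t"] by simp

lemma topical_add:
  assumes "topical F"
  shows "topical (\<lambda>x. g + F x)"
  using assms by (auto simp: topical_def mono_def add.assoc)

section \<open>Nonexpansiveness, continuity and accretivity\<close>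

lemma topical_diff_le:
  assumes "topical F" and "\<And>i. x $ i - y $ i \<le> t"
  shows "F x $ i - F y $ i \<le> t"
proof -
  have "x \<le> y + t *\<^sub>R 1"
    using assms(2) by (simp add: less_eq_vec_def algebra_simps)
  then have "F x \<le> F (y + t *\<^sub>R 1)"
    using assms(1) unfolding topical_def by (blast dest: monoD)
  then show ?thesis
    by (simp add: topical_add_const[OF assms(1)] less_eq_vec_def algebra_simps)
qed

text \<open>\<open>topical_diff_le\<close> is used with the maximum of \<open>x - y\<close> and with
  its negated minimum, so all coordinates of \<open>F x - F y\<close> lie between these two
  extremes.\<close>

lemma topical_hilbert_nonexpansive:
  assumes "topical F"
  shows "hilbert_seminorm (F x - F y) \<le> hilbert_seminorm (x - y)"
proof -
  let ?R = "range (\<lambda>i. (x - y) $ i)"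
  have "F x $ i - F y $ i \<le> Max ?R" for i
    by (rule topical_diff_le[OF assms]) (auto intro!: Max_ge)
  moreover have "F y $ i - F x $ i \<le> - Min ?R" for i
  proof (rule topical_diff_le[OF assms])
    fix i
    have "Min ?R \<le> (x - y) $ i"
      by (intro Min_le) auto
    then show "y $ i - x $ i \<le> - Min ?R"
      unfolding vector_minus_component by linarith
  qed
  ultimately have "(F x - F y) $ i - (F x - F y) $ j \<le> Max ?R - Min ?R" for i j
    unfolding vector_minus_component[of "F x"] by (smt (verit))
  then show ?thesis
    unfolding hilbert_seminorm_le_iff hilbert_seminorm_def[of "x - y"] by blast
qed

lemma topical_lipschitz_component:
  assumes "topical F"
  shows "\<bar>F x $ i - F y $ i\<bar> \<le> norm (x - y)"
proof -
  have "x $ k - y $ k \<le> norm (x - y)" "y $ k - x $ k \<le> norm (x - y)" for k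
    using component_le_norm_cart[of "x - y" k] by auto
  then have "F x $ i - F y $ i \<le> norm (x - y)" "F y $ i - F x $ i \<le> norm (x - y)"
    by (intro topical_diff_le[OF assms]; blast)+
  then show ?thesis
    by linarith
qed

lemma topical_continuous:
  assumes "topical F"
  shows "continuous_on S F"
proof -
  \<comment> \<open>The crude factor comes from bounding the Euclidean norm by the sum of the
    coordinates; any constant would give continuity.\<close>
  have "norm (F x - F y) \<le> real CARD('a) * norm (x - y)" for x y
  proof -
    have "norm (F x - F y) \<le> (\<Sum>i\<in>UNIV. \<bar>(F x - F y) $ i\<bar>)"
      by (rule norm_le_l1_cart)
    also have "\<dots> \<le> (\<Sum>i\<in>(UNIV :: 'a set). norm (x - y))"
      by (intro sum_mono) (simp add: topical_lipschitz_component[OF assms])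
    finally show ?thesis
      by simp
  qed
  then have "(real CARD('a))-lipschitz_on S F"
    by (intro lipschitz_onI) (auto simp: dist_norm)
  then show ?thesis
    by (rule lipschitz_on_continuous_on)
qed

text \<open>Split \<open>(1 + s)\<close> times \<open>x - y\<close> into the right-hand argument and
  \<open>s\<close> times \<open>F x - F y\<close>; by nonexpansiveness the second part costs at most
  \<open>s\<close> of the factor \<open>1 + s\<close>.\<close>

lemma topical_accretive:
  assumes "topical F" and "0 \<le> s"
  shows "hilbert_seminorm (x - y) \<le>
    hilbert_seminorm (x - y + s *\<^sub>R ((x - F x) - (y - F y)))"
proof -
  have "(1 + s) *\<^sub>R (x - y) = (x - y + s *\<^sub>R ((x - F x) - (y - F y))) + s *\<^sub>R (F x - F y)"
    by (simp add: algebra_simps)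
  then have "(1 + s) * hilbert_seminorm (x - y) \<le>
      hilbert_seminorm (x - y + s *\<^sub>R ((x - F x) - (y - F y)))
      + s * hilbert_seminorm (F x - F y)"
    by (metis add_nonneg_nonneg assms(2) hilbert_seminorm_scaleR hilbert_seminorm_triangle
        zero_le_one)
  moreover have "s * hilbert_seminorm (F x - F y) \<le> s * hilbert_seminorm (x - y)"
    by (intro mult_left_mono topical_hilbert_nonexpansive assms)
  ultimately show ?thesis
    by (simp add: algebra_simps)
qed

section \<open>From bounded slices to solvability\<close>

lemma topical_discounted_fixed_point:
  fixes F :: "real ^ 'n::finite \<Rightarrow> real ^ 'n"
  assumes "topical F" and M: "\<And>i. \<bar>F 0 $ i\<bar> \<le> M" and d: "0 < \<delta>" "\<delta> < 1"
  obtains x where "F ((1 - \<delta>) *\<^sub>R x) = x" and "\<And>i. \<bar>\<delta> * x $ i\<bar> \<le> M"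
proof -
  \<comment> \<open>The radius \<open>R = M / \<delta>\<close> solves
    \<open>M + (1 - \<delta>) * R = R\<close>, which makes the box invariant. It also yields the
    bound on \<open>\<delta> * x $ i\<close>, uniform in \<open>\<delta>\<close>.\<close>
  let ?B = "cbox (- (M / \<delta>) *\<^sub>R 1) ((M / \<delta>) *\<^sub>R 1) :: (real ^ 'n) set"
  have "0 \<le> M"
    using M[of undefined] by linarith
  have mem: "x \<in> ?B \<longleftrightarrow> (\<forall>i. \<bar>x $ i\<bar> \<le> M / \<delta>)" for x
    by (auto simp: mem_box_cart abs_le_iff) (smt (verit))+
  have "F ((1 - \<delta>) *\<^sub>R x) \<in> ?B" if "x \<in> ?B" for x
    unfolding mem
  proof
    fix i
    have x: "\<bar>(1 - \<delta>) * x $ k\<bar> \<le> (1 - \<delta>) * (M / \<delta>)" for k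
      using that d unfolding mem abs_mult by (intro mult_mono) auto
    have "F ((1 - \<delta>) *\<^sub>R x) $ i - F 0 $ i \<le> (1 - \<delta>) * (M / \<delta>)"
      by (rule topical_diff_le[OF assms(1)]) (use x in \<open>simp add: abs_le_iff\<close>)
    moreover have "F 0 $ i - F ((1 - \<delta>) *\<^sub>R x) $ i \<le> (1 - \<delta>) * (M / \<delta>)"
      by (rule topical_diff_le[OF assms(1)]) (use x in \<open>simp add: abs_le_iff\<close>)
    moreover have "(1 - \<delta>) * (M / \<delta>) = M / \<delta> - M"
      using d by (simp add: field_simps)
    ultimately show "\<bar>F ((1 - \<delta>) *\<^sub>R x) $ i\<bar> \<le> M / \<delta>"
      using M[of i] by linarith
  qed
  moreover have "continuous_on ?B (\<lambda>x. F ((1 - \<delta>) *\<^sub>R x))"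
    by (rule continuous_on_compose2[OF topical_continuous[OF assms(1), of UNIV]])
      (auto intro!: continuous_intros)
  moreover have "?B \<noteq> {}"
    using mem[of 0] \<open>0 \<le> M\<close> d by auto
  ultimately obtain x where x: "x \<in> ?B" "F ((1 - \<delta>) *\<^sub>R x) = x"
    using brouwer[of ?B "\<lambda>x. F ((1 - \<delta>) *\<^sub>R x)"] by (auto simp: convex_box)
  have "\<bar>\<delta> * x $ i\<bar> \<le> M" for i
  proof -
    have "\<bar>x $ i\<bar> \<le> M / \<delta>"
      using x(1) by (simp only: mem)
    then show ?thesis
      using d by (simp add: abs_mult field_simps)
  qed
  with x(2) show ?thesis
    using that by blast
qed

lemma topical_solvable_if_slices_bounded:
  fixes F :: "real ^ 'n::finite \<Rightarrow> real ^ 'n"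
  assumes F: "topical F" and bdd: "\<And>\<alpha> \<beta>. hilbert_bounded (slice_space F \<alpha> \<beta>)"
  shows "ergodic_eq_solvable F"
proof -
  define M where "M = norm (F 0)"
  \<comment> \<open>The shift by 2 gives \<open>\<delta> k \<le> 1 / 2\<close> already for
    \<open>k = 0\<close>, so dividing by \<open>1 - \<delta> k\<close> costs at most a factor
    2.\<close>
  define \<delta> where "\<delta> k = 1 / (real k + 2)" for k :: nat
  have d: "0 < \<delta> k" "\<delta> k < 1" "\<delta> k \<le> 1 / 2" for k
    by (auto simp: \<delta>_def field_simps)
  have "\<exists>x. F ((1 - \<delta> k) *\<^sub>R x) = x \<and> (\<forall>i. \<bar>\<delta> k * x $ i\<bar> \<le> M)" for k
    by (rule topical_discounted_fixed_point[OF F _ d(1,2), of M k])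
      (auto simp: M_def component_le_norm_cart)
  then obtain x where x: "F ((1 - \<delta> k) *\<^sub>R x k) = x k" "\<bar>\<delta> k * x k $ i\<bar> \<le> M" for k i
    by metis
  define y where "y k = (1 - \<delta> k) *\<^sub>R x k" for k
  have Fy: "F (y k) = y k + \<delta> k *\<^sub>R x k" for k
    using x(1)[of k] by (simp add: y_def algebra_simps)
  have "y k \<in> slice_space F (- M) M" for k
    using x(2)[of k] by (auto simp: slice_space_def Fy less_eq_vec_def abs_le_iff) (smt (verit))+
  then obtain B where B: "hilbert_seminorm (y k) \<le> B" for k
    using bdd[of "- M" M] by (auto simp: hilbert_bounded_def)
  \<comment> \<open>Normalising to minimum 0 moves the points into one box and leaves
    \<open>F (y k) - y k\<close> unchanged.\<close>
  define u where "u k = y k - Min (range (($) (y k))) *\<^sub>R 1" for k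
  have Fu: "F (u k) = u k + \<delta> k *\<^sub>R x k" for k
    by (simp add: u_def topical_diff_const[OF F] Fy)
  have "u k \<in> cbox 0 (B *\<^sub>R 1)" for k
    using normalised_in_cbox[of "y k"] B[of k] unfolding u_def
    by (auto simp: mem_box_cart intro: order_trans)
  then obtain l r where l: "strict_mono r" "(u \<circ> r) \<longlonglongrightarrow> l"
    using compact_cbox[of 0 "B *\<^sub>R (1 :: real ^ 'n)"] unfolding compact_def by metis
  define v where "v = F l - l"
  have "isCont F l"
    using topical_continuous[OF F, of UNIV] by (simp add: continuous_on_eq_continuous_at)
  then have "(\<lambda>k. F (u (r k)) - u (r k)) \<longlonglongrightarrow> v"
    using l(2) unfolding v_def o_def by (intro tendsto_diff isCont_tendsto_compose[of _ F])
  then have lim: "(\<lambda>k. \<delta> (r k) *\<^sub>R x (r k)) \<longlonglongrightarrow> v"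
    by (simp add: Fu)
  \<comment> \<open>Since \<open>i\<close> and \<open>j\<close> can be exchanged, this forces all
    coordinates of \<open>v\<close> to agree. The differences within \<open>\<delta> k * x k\<close>
    are at most \<open>\<delta> k * (2 * B)\<close>, because \<open>y k\<close> has seminorm at most
    \<open>B\<close>.\<close>
  have diff: "v $ i - v $ j \<le> 0" for i j
  proof (rule LIMSEQ_le)
    show "(\<lambda>k. (\<delta> (r k) *\<^sub>R x (r k)) $ i - (\<delta> (r k) *\<^sub>R x (r k)) $ j) \<longlonglongrightarrow> v $ i - v $ j"
      by (intro tendsto_diff tendsto_vec_nth lim)
    have "(\<lambda>k. \<delta> k * (2 * B)) \<longlonglongrightarrow> 0"
      unfolding \<delta>_def by real_asymp
    then show "(\<lambda>k. \<delta> (r k) * (2 * B)) \<longlonglongrightarrow> 0"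
      using LIMSEQ_subseq_LIMSEQ[OF _ l(1)] by (auto simp: o_def)
    have "\<delta> k * x k $ i - \<delta> k * x k $ j \<le> \<delta> k * (2 * B)" for k
    proof -
      have "(1 - \<delta> k) * (x k $ i - x k $ j) \<le> B"
        using diff_le_hilbert_seminorm[of "y k" i j] B[of k] by (simp add: y_def algebra_simps)
      \<comment> \<open>Replacing \<open>1 - \<delta> k\<close> by \<open>1 / 2\<close> decreases
        the product only for a nonnegative difference; hence the case split.\<close>
      have "x k $ i - x k $ j \<le> 2 * B"
      proof (cases "x k $ i - x k $ j \<le> 0")
        case True
        have "0 \<le> B"
          using B[of k] hilbert_seminorm_nonneg[of "y k"] by linarith
        with True show ?thesis
          by linarith
      next
        case False
        then have "1 / 2 * (x k $ i - x k $ j) \<le> (1 - \<delta> k) * (x k $ i - x k $ j)"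
          using d(3)[of k] by (intro mult_right_mono) auto
        then have "1 / 2 * (x k $ i - x k $ j) \<le> B"
          using \<open>(1 - \<delta> k) * (x k $ i - x k $ j) \<le> B\<close> by (rule order_trans)
        then show ?thesis
          by simp
      qed
      then have "\<delta> k * (x k $ i - x k $ j) \<le> \<delta> k * (2 * B)"
        using d(1)[of k] by (intro mult_left_mono) auto
      then show ?thesis
        by (simp add: algebra_simps)
    qed
    then show "\<exists>N. \<forall>k\<ge>N. (\<delta> (r k) *\<^sub>R x (r k)) $ i - (\<delta> (r k) *\<^sub>R x (r k)) $ j
        \<le> \<delta> (r k) * (2 * B)"
      by simp
  qed
  have "v = (v $ undefined) *\<^sub>R 1"
    using diff by (auto simp: vec_eq_iff intro: antisym)
  then have "F l = (v $ undefined) *\<^sub>R 1 + l"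
    by (metis v_def diff_add_cancel)
  then show ?thesis
    unfolding ergodic_eq_solvable_def by blast
qed

section \<open>From solvability to bounded slices\<close>

lemma topical_slices_bounded_if_solvable:
  fixes F :: "real ^ 'n::finite \<Rightarrow> real ^ 'n"
  assumes F: "topical F" and solv: "\<And>g. ergodic_eq_solvable (\<lambda>x. g + F x)"
  shows "hilbert_bounded (slice_space F \<alpha> \<beta>)"
proof (rule ccontr)
  assume "\<not> ?thesis"
  then have "\<exists>x. x \<in> slice_space F \<alpha> \<beta> \<and> hilbert_seminorm x > real k" for k :: nat
    by (auto simp: hilbert_bounded_def not_le)
  then obtain x where x: "x k \<in> slice_space F \<alpha> \<beta>" "hilbert_seminorm (x k) > real k" for k
    by metis
  define \<rho> where "\<rho> k = hilbert_seminorm (x k)" for k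
  have \<rho>_pos: "0 < \<rho> k" for k
    using x(2)[of k] by (simp add: \<rho>_def)
  define m where "m k = Min (range (($) (x k)))" for k
  \<comment> \<open>The direction of \<open>x k\<close> modulo constants: minimum 0 and maximum
    1.\<close>
  define w where "w k = (1 / \<rho> k) *\<^sub>R (x k - m k *\<^sub>R 1)" for k
  have "w k \<in> cbox 0 1" for k
    using normalised_in_cbox[of "x k"] \<rho>_pos[of k]
    by (simp add: mem_box_cart w_def m_def \<rho>_def field_simps)
  then obtain d r where r: "strict_mono r" and "(w \<circ> r) \<longlonglongrightarrow> d"
    using compact_cbox[of 0 "1 :: real ^ 'n"] unfolding compact_def by metis
  \<comment> \<open>The seminorm is at most twice the norm, so the tolerance 1/8 becomes the share
    1/4 of \<open>\<rho> k\<close> below.\<close>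
  then have "\<forall>\<^sub>F k in sequentially. dist ((w \<circ> r) k) d < 1 / 8"
    by (intro tendstoD[where f = "w \<circ> r"]) auto
  then obtain N where N: "\<And>k. k \<ge> N \<Longrightarrow> norm (w (r k) - d) < 1 / 8"
    by (auto simp: eventually_sequentially dist_norm)
  \<comment> \<open>On the slice, \<open>x - F x\<close> has seminorm at most \<open>C / 2\<close>,
    so multiplied by \<open>s = \<rho> k / C\<close> it contributes at most half of
    \<open>\<rho> k\<close>. The summand 1 keeps \<open>C\<close> positive when
    \<open>\<alpha> = \<beta>\<close>.\<close>
  define C where "C = 2 * (\<bar>\<beta> - \<alpha>\<bar> + 1)"
  have "C > 0"
    unfolding C_def by (rule mult_pos_pos) (auto intro: add_nonneg_pos)
  obtain lam z where z: "C *\<^sub>R d + F z = lam *\<^sub>R 1 + z"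
    using solv[of "C *\<^sub>R d"] by (auto simp: ergodic_eq_solvable_def)
  \<comment> \<open>The index is past \<open>N\<close>, so \<open>w k\<close> is close to
    \<open>d\<close>. It is also at least 8 times the seminorm of \<open>z\<close>, because
    \<open>r n \<ge> n\<close>, and \<open>\<rho> k\<close> exceeds \<open>k\<close>.\<close>
  define k where "k = r (max N (nat \<lceil>8 * hilbert_seminorm z\<rceil>))"
  have "norm (w k - d) < 1 / 8"
    unfolding k_def by (intro N) simp
  have "real (max N (nat \<lceil>8 * hilbert_seminorm z\<rceil>)) \<le> real k"
    unfolding k_def using seq_suble[OF r] by (simp only: of_nat_le_iff)
  then have "8 * hilbert_seminorm z < \<rho> k"
    using x(2)[of k] unfolding \<rho>_def by linarith
  define s where "s = \<rho> k / C"
  have "0 \<le> s"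
    using \<open>C > 0\<close> \<rho>_pos[of k] by (simp add: s_def)
  \<comment> \<open>With this \<open>s\<close> the term \<open>s (z - F z)\<close> cancels the leading part \<open>\<rho> k d\<close> of \<open>x k\<close>.\<close>
  have zF: "z - F z = C *\<^sub>R d - lam *\<^sub>R 1"
    using z by (simp add: algebra_simps)
  have xk: "x k = \<rho> k *\<^sub>R w k + m k *\<^sub>R 1"
    using \<rho>_pos[of k] by (simp add: w_def)
  have sC: "s * C = \<rho> k"
    using \<open>C > 0\<close> by (simp add: s_def)
  have "x k - z + s *\<^sub>R ((x k - F (x k)) - (z - F z)) =
      \<rho> k *\<^sub>R (w k - d) + - z + s *\<^sub>R (x k - F (x k)) + (m k + s * lam) *\<^sub>R 1"
    unfolding zF by (subst (1) xk) (simp add: algebra_simps flip: sC)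
  then have "hilbert_seminorm (x k - z) \<le>
      hilbert_seminorm (\<rho> k *\<^sub>R (w k - d) + - z + s *\<^sub>R (x k - F (x k)))"
    using topical_accretive[OF F \<open>0 \<le> s\<close>, of "x k" z]
    by (simp only: hilbert_seminorm_add_const)
  also have "\<dots> \<le> hilbert_seminorm (\<rho> k *\<^sub>R (w k - d)) + hilbert_seminorm (- z)
      + hilbert_seminorm (s *\<^sub>R (x k - F (x k)))"
    by (meson add_right_mono hilbert_seminorm_triangle order_trans)
  also have "hilbert_seminorm (\<rho> k *\<^sub>R (w k - d)) \<le> \<rho> k * (1 / 4)"
    using hilbert_seminorm_le_norm[of "w k - d"] \<open>norm (w k - d) < 1 / 8\<close> \<rho>_pos[of k]
    by (simp only: hilbert_seminorm_scaleR less_imp_le) (intro mult_left_mono; simp)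
  also have "hilbert_seminorm (s *\<^sub>R (x k - F (x k))) \<le> \<rho> k * (1 / 2)"
  proof -
    have "hilbert_seminorm (x k - F (x k)) \<le> \<bar>\<beta> - \<alpha>\<bar>"
      unfolding hilbert_seminorm_le_iff
    proof (intro allI)
      fix i j
      have "\<alpha> + x k $ j \<le> F (x k) $ j" "F (x k) $ j \<le> \<beta> + x k $ j"
        "\<alpha> + x k $ i \<le> F (x k) $ i" "F (x k) $ i \<le> \<beta> + x k $ i"
        using x(1)[of k] by (auto simp: slice_space_def less_eq_vec_def)
      then show "(x k - F (x k)) $ i - (x k - F (x k)) $ j \<le> \<bar>\<beta> - \<alpha>\<bar>"
        by simp
    qed
    then have "hilbert_seminorm (x k - F (x k)) \<le> C / 2"
      by (simp add: C_def)
    then have "s * hilbert_seminorm (x k - F (x k)) \<le> s * (C / 2)"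
      using \<open>0 \<le> s\<close> by (rule mult_left_mono)
    then show ?thesis
      using sC \<open>0 \<le> s\<close> by (simp add: hilbert_seminorm_scaleR)
  qed
  \<comment> \<open>With the triangle inequality, \<open>\<rho> k / 4\<close> is at most twice the
    seminorm of \<open>z\<close>, contradicting the choice of \<open>k\<close>; this is where the
    factor 8 comes from.\<close>
  finally have "hilbert_seminorm (x k - z) \<le> \<rho> k * (1 / 4) + hilbert_seminorm z + \<rho> k * (1 / 2)"
    by simp
  moreover have "\<rho> k \<le> hilbert_seminorm (x k - z) + hilbert_seminorm z"
    using hilbert_seminorm_triangle[of "x k - z" z] by (simp add: \<rho>_def)
  ultimately show False
    using \<open>8 * hilbert_seminorm z < \<rho> k\<close> hilbert_seminorm_nonneg[of z] by linarith
qed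

section \<open>Perturbation by a vector\<close>

lemma hilbert_bounded_subset:
  assumes "hilbert_bounded S" and "R \<subseteq> S"
  shows "hilbert_bounded R"
  using assms by (auto simp: hilbert_bounded_def)

text \<open>Adding \<open>g\<close> moves each coordinate by at most \<open>norm g\<close>.
  Boundedness of all slices thus passes from \<open>F\<close> to every \<open>g + F\<close>.\<close>

lemma slice_space_add_subset:
  "slice_space (\<lambda>x. g + F x) \<alpha> \<beta> \<subseteq> slice_space F (\<alpha> - norm g) (\<beta> + norm g)"
proof
  fix x assume x: "x \<in> slice_space (\<lambda>x. g + F x) \<alpha> \<beta>"
  have "\<alpha> - norm g + x $ i \<le> F x $ i \<and> F x $ i \<le> \<beta> + norm g + x $ i" for i
  proof -
    have "\<alpha> + x $ i \<le> g $ i + F x $ i" "g $ i + F x $ i \<le> \<beta> + x $ i"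
      using x by (auto simp: slice_space_def less_eq_vec_def)
    then show ?thesis
      using component_le_norm_cart[of g i] by linarith
  qed
  then show "x \<in> slice_space F (\<alpha> - norm g) (\<beta> + norm g)"
    by (auto simp: slice_space_def less_eq_vec_def)
qed

theorem topical_ergodic_iff:
  assumes "topical F"
  shows "(\<forall>g. ergodic_eq_solvable (\<lambda>x. g + F x)) \<longleftrightarrow>
    (\<forall>\<alpha> \<beta>. hilbert_bounded (slice_space F \<alpha> \<beta>))"
proof (intro iffI allI)
  fix g assume "\<forall>\<alpha> \<beta>. hilbert_bounded (slice_space F \<alpha> \<beta>)"
  then have "hilbert_bounded (slice_space (\<lambda>x. g + F x) \<alpha> \<beta>)" for \<alpha> \<beta>
    using hilbert_bounded_subset[OF _ slice_space_add_subset] by blast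
  then show "ergodic_eq_solvable (\<lambda>x. g + F x)"
    by (rule topical_solvable_if_slices_bounded[OF topical_add[OF assms]])
qed (use topical_slices_bounded_if_solvable[OF assms] in blast)


section \<open>The Shapley operator\<close>

text \<open>The negative part has integral 0, which rules out the case of two infinite parts. The
  weights of the coordinates in \<open>stage_value\<close> are therefore nonnegative, which gives
  its monotonicity in \<open>x\<close>.\<close>

lemma mixed_ext_trans:
  "mixed_ext c (\<lambda>k. measure (P k) {l}) i \<mu> \<nu> =
    enn2ereal (\<integral>\<^sup>+ (a, b). ennreal (measure (P (i, a, b)) {l}) \<partial>(\<mu> \<Otimes>\<^sub>M \<nu>))"
  by (simp add: mixed_ext_def Let_def ennreal_neg case_prod_beta' zero_ennreal.rep_eq)

lemma stage_value_mono:
  assumes "x \<le> y"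
  shows "stage_value c G x i \<mu> \<nu> \<le> stage_value c G y i \<mu> \<nu>"
  unfolding stage_value_def
  using assms
  by (intro add_left_mono sum_mono ereal_mult_right_mono)
    (simp_all add: less_eq_vec_def mixed_ext_trans)

text \<open>The integral commutes with the finite sum over states, so an average of probability
  vectors has total mass 1. Real weights \<open>q\<close> allow the distributive law, which is
  delicate in \<open>ereal\<close>.\<close>

lemma trans_prob_mixed_ext:
  fixes G :: "('n::finite, 'a::polish_space, 'b::polish_space) game"
  assumes "stochastic_game G"
    and \<mu>: "\<mu> \<in> borel_probs (actions_max G i)" and \<nu>: "\<nu> \<in> borel_probs (actions_min G i)"
  obtains q :: "'n \<Rightarrow> real"
  where "\<And>l. mixed_ext c (\<lambda>k. measure (trans_prob G k) {l}) i \<mu> \<nu> = ereal (q l)"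
    and "(\<Sum>l\<in>UNIV. q l) = 1"
proof -
  let ?P = "\<lambda>l (a, b). measure (trans_prob G (i, a, b)) {l}"
  have "prob_space \<mu>" "prob_space \<nu>"
    using \<mu> \<nu> by (auto simp: borel_probs_def space_prob_algebra)
  then interpret pair_prob_space \<mu> \<nu>
    by (simp add: pair_prob_space_def pair_sigma_finite_def prob_space_imp_sigma_finite)
  have sets: "sets \<mu> = sets (restrict_space borel (actions_max G i))"
      "sets \<nu> = sets (restrict_space borel (actions_min G i))"
    using \<mu> \<nu> by (auto simp: borel_probs_def space_prob_algebra)
  have space: "space \<mu> = actions_max G i" "space \<nu> = actions_min G i"
    using sets[THEN sets_eq_imp_space_eq] by (auto simp: space_restrict_space)
  have [measurable]: "(\<lambda>a. a) \<in> \<mu> \<rightarrow>\<^sub>M borel" "(\<lambda>b. b) \<in> \<nu> \<rightarrow>\<^sub>M borel"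
    by (auto simp: measurable_cong_sets[OF sets(1) refl] measurable_cong_sets[OF sets(2) refl]
        intro!: measurable_restrict_space1)
  \<comment> \<open>The transition function is measurable on \<open>game_K G\<close> only; the
    product of \<open>\<mu>\<close> and \<open>\<nu>\<close> lives on pairs of available actions,
    which are mapped into that set.\<close>
  have "(\<lambda>w. (i, fst w, snd w)) \<in> \<mu> \<Otimes>\<^sub>M \<nu> \<rightarrow>\<^sub>M borel_K G"
    unfolding borel_K_def
  proof (rule measurable_restrict_space2)
    show "(\<lambda>w. (i, fst w, snd w)) \<in> space (\<mu> \<Otimes>\<^sub>M \<nu>) \<rightarrow> game_K G"
      by (auto simp: space_pair_measure space game_K_def)
    show "(\<lambda>w. (i, fst w, snd w)) \<in> \<mu> \<Otimes>\<^sub>M \<nu> \<rightarrow>\<^sub>M count_space UNIV \<Otimes>\<^sub>M (borel \<Otimes>\<^sub>M borel)"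
      by measurable
  qed
  moreover have "trans_prob G \<in> borel_K G \<rightarrow>\<^sub>M prob_algebra (count_space UNIV)"
    using assms(1) by (simp add: stochastic_game_def)
  ultimately have tr: "(\<lambda>w. trans_prob G (i, fst w, snd w)) \<in> \<mu> \<Otimes>\<^sub>M \<nu> \<rightarrow>\<^sub>M prob_algebra (count_space UNIV)"
    by (rule measurable_compose)
  have meas [measurable]: "?P l \<in> borel_measurable (\<mu> \<Otimes>\<^sub>M \<nu>)" for l
    using measurable_compose[OF measurable_prob_algebraD[OF tr] measurable_measure_subprob_algebra[of "{l}"]]
    by (simp add: case_prod_beta')
  have prob: "(\<Sum>l\<in>UNIV. ?P l w) = 1" if "w \<in> space (\<mu> \<Otimes>\<^sub>M \<nu>)" for w
  proof -
    have "trans_prob G (i, fst w, snd w) \<in> space (prob_algebra (count_space UNIV))"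
      using measurable_space[OF tr that] .
    then have *: "prob_space (trans_prob G (i, fst w, snd w))"
      and s: "sets (trans_prob G (i, fst w, snd w)) = UNIV"
      by (auto simp: space_prob_algebra)
    interpret N: prob_space "trans_prob G (i, fst w, snd w)" by fact
    have "space (trans_prob G (i, fst w, snd w)) = UNIV"
      using s sets.space_closed[of "trans_prob G (i, fst w, snd w)"] by auto
    then have "(\<Sum>l\<in>UNIV. measure (trans_prob G (i, fst w, snd w)) {l}) = 1"
      using N.finite_measure_eq_sum_singleton[of UNIV] N.prob_space s by simp
    then show ?thesis
      by (simp add: case_prod_beta')
  qed
  let ?I = "\<lambda>l. \<integral>\<^sup>+ w. ennreal (?P l w) \<partial>(\<mu> \<Otimes>\<^sub>M \<nu>)"
  have "(\<Sum>l\<in>UNIV. ?I l) = (\<integral>\<^sup>+ w. (\<Sum>l\<in>UNIV. ennreal (?P l w)) \<partial>(\<mu> \<Otimes>\<^sub>M \<nu>))"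
    by (intro nn_integral_sum[symmetric] measurable_compose[OF meas measurable_ennreal])
  also have "\<dots> = (\<integral>\<^sup>+ w. 1 \<partial>(\<mu> \<Otimes>\<^sub>M \<nu>))"
  proof (rule nn_integral_cong)
    fix w assume "w \<in> space (\<mu> \<Otimes>\<^sub>M \<nu>)"
    have "(\<Sum>l\<in>UNIV. ennreal (?P l w)) = ennreal (\<Sum>l\<in>UNIV. ?P l w)"
      by (intro sum_ennreal) (auto simp: case_prod_beta')
    also have "\<dots> = 1"
      by (simp only: prob[OF \<open>w \<in> _\<close>] ennreal_1)
    finally show "(\<Sum>l\<in>UNIV. ennreal (?P l w)) = 1" .
  qed
  also have "\<dots> = 1"
    by (simp add: P.emeasure_space_1)
  finally have sum: "(\<Sum>l\<in>UNIV. ?I l) = 1" .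
  have fin: "?I l < top" for l
  proof -
    have "?I l \<le> (\<Sum>l\<in>UNIV. ?I l)"
      by (rule member_le_sum) auto
    then show ?thesis
      unfolding sum by (rule le_less_trans) simp
  qed
  show ?thesis
  proof (rule that)
    fix l
    have "mixed_ext c (\<lambda>k. measure (trans_prob G k) {l}) i \<mu> \<nu> = enn2ereal (?I l)"
      by (simp add: mixed_ext_trans case_prod_beta')
    also have "\<dots> = ereal (enn2real (?I l))"
      using fin[of l] by (cases "?I l") (auto simp: enn2ereal_ennreal)
    finally show "mixed_ext c (\<lambda>k. measure (trans_prob G k) {l}) i \<mu> \<nu> = ereal (enn2real (?I l))" .
  next
    have "(\<Sum>l\<in>UNIV. enn2real (?I l)) = enn2real (\<Sum>l\<in>UNIV. ?I l)"
      using fin by (subst enn2real_sum) (auto simp: o_def)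
    then show "(\<Sum>l\<in>UNIV. enn2real (?I l)) = 1"
      unfolding sum by simp
  qed
qed

section \<open>Additive homogeneity and monotonicity of the Shapley operator\<close>

lemma stage_value_add_const:
  assumes "stochastic_game G"
    and "\<mu> \<in> borel_probs (actions_max G i)" and "\<nu> \<in> borel_probs (actions_min G i)"
  shows "stage_value c G (x + t *\<^sub>R 1) i \<mu> \<nu> = stage_value c G x i \<mu> \<nu> + ereal t"
proof -
  obtain q where q: "\<And>l. mixed_ext c (\<lambda>k. measure (trans_prob G k) {l}) i \<mu> \<nu> = ereal (q l)"
    "(\<Sum>l\<in>UNIV. q l) = 1"
    using trans_prob_mixed_ext[OF assms, where c = c] by blast
  \<comment> \<open>The computation is done in the reals; the payoff term, possibly infinite, is
    only reassociated afterwards.\<close>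
  have "(\<Sum>l\<in>UNIV. (x $ l + t) * q l) = (\<Sum>l\<in>UNIV. x $ l * q l) + t"
    using q(2) by (simp add: distrib_right sum.distrib flip: sum_distrib_left)
  then show ?thesis
    by (simp add: stage_value_def q(1) add.assoc)
qed

text \<open>Adding a real is an order automorphism of \<open>ereal\<close> whose inverse adds
  \<open>- t\<close>, so the easy inequality for \<open>t\<close> and for \<open>- t\<close> gives
  both directions.\<close>

lemma INF_ereal_add_real: "(INF i\<in>I. f i + ereal t) = (INF i\<in>I. f i) + ereal t"
proof (rule antisym)
  have *: "(INF i\<in>I. g i) + ereal s \<le> (INF i\<in>I. g i + ereal s)" for g s
    by (intro INF_greatest add_right_mono INF_lower)
  show "(INF i\<in>I. f i) + ereal t \<le> (INF i\<in>I. f i + ereal t)"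
    by (rule *)
  have cancel: "a + ereal s + ereal (- s) = a" for a s
    by (cases a) auto
  have "(INF i\<in>I. f i + ereal t) + ereal (- t) \<le> (INF i\<in>I. f i)"
    using *[of "\<lambda>i. f i + ereal t" "- t"] unfolding cancel .
  then have "(INF i\<in>I. f i + ereal t) + ereal (- t) + ereal t \<le> (INF i\<in>I. f i) + ereal t"
    by (rule add_right_mono)
  then show "(INF i\<in>I. f i + ereal t) \<le> (INF i\<in>I. f i) + ereal t"
    using cancel[of _ "- t"] by simp
qed

lemma shapley_sup_inf_finite:
  assumes "shapley_well_defined c G"
  shows "\<bar>shapley_sup_inf c G x i\<bar> \<noteq> \<infinity>"
  using assms[unfolded shapley_well_defined_def, rule_format, of x i] by (rule conjunct2)

lemma shapley_sup_inf_add_const: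
  assumes "stochastic_game G" and "shapley_well_defined c G"
  shows "shapley_sup_inf c G (x + t *\<^sub>R 1) i = shapley_sup_inf c G x i + ereal t"
proof -
  let ?A = "borel_probs (actions_max G i)" and ?B = "borel_probs (actions_min G i)"
  \<comment> \<open>A supremum over the empty set would be \<open>-\<infinity>\<close>, so
    finiteness provides a mixed action of Max, as required to move \<open>t\<close> out of the
    supremum.\<close>
  have "\<bar>shapley_sup_inf c G x i\<bar> \<noteq> \<infinity>"
    by (rule shapley_sup_inf_finite[OF assms(2)])
  then have ne: "?A \<noteq> {}"
    by (auto simp: shapley_sup_inf_def bot_ereal_def)
  have "shapley_sup_inf c G (x + t *\<^sub>R 1) i =
      (SUP \<mu>\<in>?A. INF \<nu>\<in>?B. stage_value c G x i \<mu> \<nu> + ereal t)"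
    unfolding shapley_sup_inf_def
    by (intro SUP_cong INF_cong refl stage_value_add_const assms)
  also have "\<dots> = (SUP \<mu>\<in>?A. (INF \<nu>\<in>?B. stage_value c G x i \<mu> \<nu>) + ereal t)"
    by (intro SUP_cong refl INF_ereal_add_real)
  also have "\<dots> = shapley_sup_inf c G x i + ereal t"
    unfolding shapley_sup_inf_def using ne by (intro SUP_ereal_add_left) auto
  finally show ?thesis .
qed

lemma topical_shapley_operator:
  assumes "stochastic_game G" and "shapley_well_defined c G"
  shows "topical (shapley_operator c G)"
  unfolding topical_def
proof (intro conjI allI monoI)
  \<comment> \<open>\<open>real_of_ereal\<close> sends both infinities to 0; finiteness is what
    makes it respect the order and the addition of \<open>t\<close>.\<close>
  have fin: "\<bar>shapley_sup_inf c G x i\<bar> \<noteq> \<infinity>" for x i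
    by (rule shapley_sup_inf_finite[OF assms(2)])
  fix x
  show "shapley_operator c G x \<le> shapley_operator c G y" if "x \<le> y" for y
  proof -
    have le: "shapley_sup_inf c G x i \<le> shapley_sup_inf c G y i" for i
      unfolding shapley_sup_inf_def
      by (intro SUP_mono' INF_mono' stage_value_mono that)
    have "real_of_ereal (shapley_sup_inf c G x i) \<le> real_of_ereal (shapley_sup_inf c G y i)" for i
      using fin[of x i] fin[of y i] le[of i]
      by (cases "shapley_sup_inf c G x i"; cases "shapley_sup_inf c G y i") auto
    then show ?thesis
      by (simp add: less_eq_vec_def shapley_operator_def)
  qed
  show "shapley_operator c G (x + t *\<^sub>R 1) = shapley_operator c G x + t *\<^sub>R 1" for t
  proof -
    have "real_of_ereal (shapley_sup_inf c G x i + ereal t)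
        = real_of_ereal (shapley_sup_inf c G x i) + t" for i
      using fin[of x i] by (cases "shapley_sup_inf c G x i") auto
    then show ?thesis
      by (simp add: vec_eq_iff shapley_operator_def shapley_sup_inf_add_const[OF assms])
  qed
qed

theorem theorem2p6:
  fixes G :: "('n::finite, 'a::polish_space, 'b::polish_space) game"
    and c :: "'n \<Rightarrow> 'a measure \<Rightarrow> 'b measure \<Rightarrow> ereal"
  assumes "stochastic_game G"
    and "shapley_well_defined c G"
  shows "ergodic_game c G \<longleftrightarrow>
    (\<forall>\<alpha> \<beta>. hilbert_bounded (slice_space (shapley_operator c G) \<alpha> \<beta>))"
  unfolding ergodic_game_def
  using topical_ergodic_iff[OF topical_shapley_operator[OF assms]] .

end
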